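(* Let $2<p<3$ and let $s\geq\sqrt{2}$ be a real number. Then $$\int_0^\infty\left(\exp(-t^2/2)^s-|\cos(t)|^s\right)\frac{\mathrm{d}t}{t^{p+1}}\geq 0.$$
   Context: Here $\exp(-t^2/2)^s$ means $\left(\exp(-t^2/2)\right)^s=\exp(-st^2/2)$. For every $s>0$ the integrand is Lebesgue integrable on $(0,\infty)$ with respect to $\mathrm{d}t/t^{p+1}$. *)

theory Defs
  imports "HOL-Analysis.Analysis"
begin

text \<open>
  The Bochner integral of a non-integrable function is 0 by convention. The lemma
  \<open>gauss_cos_integrable\<close> below shows that this convention never applies
  to the integrand \<open>(exp (- t^2/2)^s - |cos t|^s) / t^(p+1)\<close> for \<open>2 < p < 3\<close>, \<open>s > 0\<close>.
\<close>

lemma gauss_cos_diff_bound: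
  fixes t :: real
  assumes t: "0 < t" "t \<le> 1"
  shows "\<bar>exp (- (t^2) / 2) - cos t\<bar> \<le> t^4 / 4"
    and "cos t \<ge> 1 / 2" and "exp (- (t^2) / 2) \<ge> 1 / 2"
proof -
  define u where "u = t^2 / 2"
  have t2: "t^2 \<le> 1" using t by (simp add: power_le_one)
  have u: "u \<ge> 0" "u \<le> 1/2" using t2 by (auto simp: u_def)
  have uu: "u^2 = t^4 / 4" by (simp add: u_def power_divide flip: power_mult)
  have e1: "exp (- u) \<ge> 1 - u" using exp_ge_add_one_self[of "-u"] by simp
  have "exp (- u) \<le> 1 / (1 + u)"
    using exp_ge_add_one_self[of u] u by (simp add: exp_minus field_simps)
  also have "\<dots> \<le> 1 - u + u^2"
  proof -
    have "(1 - u + u^2) * (1 + u) = 1 + u^3" by (simp add: power2_eq_square power3_eq_cube algebra_simps)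
    moreover have "u^3 \<ge> 0" using u by simp
    ultimately have "1 \<le> (1 - u + u^2) * (1 + u)" by linarith
    then show ?thesis using u by (simp add: pos_divide_le_eq)
  qed
  finally have e2: "exp (- u) \<le> 1 - u + u^2" .
  define y where "y = t / 2"
  have y: "0 < y" "y \<le> 1/2" using t by (auto simp: y_def)
  have c: "cos t = 1 - 2 * (sin y)^2" using cos_double_sin[of y] by (simp add: y_def)
  have "\<bar>sin y - (\<Sum>m<3. sin_coeff m * y ^ m)\<bar> \<le> inverse (fact 3) * \<bar>y\<bar> ^ 3"
    by (rule Maclaurin_sin_bound)
  moreover have "(\<Sum>m<3. sin_coeff m * y ^ m) = y"
    by (simp add: sin_coeff_def numeral_eq_Suc)
  ultimately have s1: "\<bar>sin y - y\<bar> \<le> y^3 / 6"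
    using y by (simp add: fact_numeral)
  have y2: "y^2 \<le> 1" using y by (simp add: power_le_one)
  have y3: "y^3 / 6 \<le> y" using mult_left_mono[OF y2, of y] y
    by (simp add: power2_eq_square power3_eq_cube)
  have s2: "(y - y^3/6)^2 \<le> (sin y)^2"
  proof (rule power_mono)
    show "y - y^3/6 \<le> sin y" using s1 by linarith
    show "0 \<le> y - y^3/6" using y3 by linarith
  qed
  have s3: "(y - y^3/6)^2 = y^2 - y^4/3 + (y^3/6)^2"
    by (simp add: power2_eq_square power3_eq_cube algebra_simps eval_nat_numeral)
  have "(sin y)^2 \<ge> y^2 - y^4/3" using s2 s3 zero_le_power2[of "y^3/6"] by linarith
  moreover have "y^2 = u / 2" "y^4 = t^4 / 16" by (auto simp: y_def u_def power_divide)
  ultimately have c1: "cos t \<le> 1 - u + t^4/24" using c by simp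
  have "(sin y)^2 \<le> y^2"
  proof -
    have "\<bar>sin y\<bar> \<le> \<bar>y\<bar>" by (rule abs_sin_x_le_abs_x)
    then show ?thesis by (simp add: abs_le_square_iff)
  qed
  then have c2: "cos t \<ge> 1 - u" using c \<open>y^2 = u/2\<close> by simp
  have "t^4 \<ge> 0" by simp
  have ex: "- (t^2) / 2 = - u" by (simp add: u_def)
  show "\<bar>exp (- (t^2) / 2) - cos t\<bar> \<le> t^4 / 4"
    unfolding ex using e1 e2 c1 c2 uu \<open>t^4 \<ge> 0\<close> by linarith
  show "cos t \<ge> 1/2" using c2 u by linarith
  show "exp (- (t^2) / 2) \<ge> 1/2" unfolding ex using e1 u by linarith
qed

lemma powr_diff_bound:
  fixes a b s :: real
  assumes "1/2 \<le> a" "a \<le> 1" "1/2 \<le> b" "b \<le> 1" "s > 0"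
  shows "\<bar>a powr s - b powr s\<bar> \<le> 2 * s * \<bar>a - b\<bar>"
proof -
  have d: "((\<lambda>x. x powr s) has_real_derivative s * x powr (s - 1)) (at x within {1/2..1})"
    if "x \<in> {1/2..1}" for x
    by (rule has_real_derivative_powr[THEN has_field_derivative_at_within]) (use that in auto)
  have "norm (s * x powr (s - 1)) \<le> 2 * s" if "x \<in> {1/2..1}" for x
  proof -
    have "x powr (s - 1) = x powr s / x" using that by (simp add: powr_diff)
    also have "\<dots> \<le> 1 / x" using that assms by (intro divide_right_mono powr_le1) auto
    also have "\<dots> \<le> 2" using that by (simp add: field_simps)
    finally show ?thesis using assms by simp
  qed
  then have "norm (a powr s - b powr s) \<le> 2 * s * norm (a - b)"
    using d assms by (intro field_differentiable_bound[of "{1/2..1}"]) auto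
  then show ?thesis by simp
qed

lemma gauss_cos_integrable:
  fixes p s :: real
  assumes p: "2 < p" "p < 3" and s: "s > 0"
  shows "set_integrable lborel {0<..}
    (\<lambda>t. ((exp (- (t^2) / 2)) powr s - \<bar>cos t\<bar> powr s) / t powr (p + 1))"
    (is "set_integrable _ _ ?f")
proof -
  have meas: "set_borel_measurable lborel A ?f" if "A \<in> sets borel" for A
    unfolding set_borel_measurable_def using that by measurable
  have "set_integrable lborel {0<..1} ?f"
  proof (rule set_integrable_bound)
    show "set_integrable lborel {0<..1} (\<lambda>t::real. s / 2)"
      unfolding set_integrable_def
      by (intro integrable_scaleR_left integrable_real_indicator) auto
    show "set_borel_measurable lborel {0<..1} ?f" by (rule meas) simp
    show "AE t in lborel. t \<in> {0<..1} \<longrightarrow> norm (?f t) \<le> norm (s / 2)"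
    proof (intro AE_I2 impI)
      fix t :: real assume "t \<in> {0<..1}"
      then have t: "0 < t" "t \<le> 1" by auto
      note b = gauss_cos_diff_bound[OF t]
      have "\<bar>(exp (- (t^2) / 2)) powr s - (cos t) powr s\<bar>
          \<le> 2 * s * \<bar>exp (- (t^2) / 2) - cos t\<bar>"
        by (rule powr_diff_bound) (use b s in auto)
      also have "\<dots> \<le> 2 * s * (t^4 / 4)"
        using b(1) s by (intro mult_left_mono) auto
      finally have h: "\<bar>(exp (- (t^2) / 2)) powr s - (cos t) powr s\<bar> \<le> 2 * s * (t^4 / 4)" .
      have "\<bar>cos t\<bar> = cos t" using b(2) by linarith
      then have "\<bar>?f t\<bar> = \<bar>(exp (- (t^2) / 2)) powr s - (cos t) powr s\<bar> / t powr (p + 1)"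
        unfolding abs_divide by (simp only: abs_of_nonneg[OF powr_ge_zero])
      also have "\<dots> \<le> 2 * s * (t^4 / 4) / t powr (p + 1)"
        by (rule divide_right_mono[OF h]) simp
      also have "\<dots> = s / 2 * t powr (3 - p)"
      proof -
        have "t powr (3 - p) = t powr 4 / t powr (p + 1)" by (simp flip: powr_diff)
        then show ?thesis using t by simp
      qed
      also have "\<dots> \<le> s / 2 * 1"
        using t p s by (intro mult_left_mono powr_le1) auto
      finally show "norm (?f t) \<le> norm (s / 2)" using s by simp
    qed
  qed
  moreover have "set_integrable lborel {1..} ?f"
  proof (rule set_integrable_bound)
    have "((\<lambda>x. x powr (-(p+1))) has_integral -(1 powr (-(p+1)+1))/(-(p+1)+1)) {1::real..}"
      by (rule has_integral_powr_to_inf) (use p in auto)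
    then have "(\<lambda>x::real. x powr (-(p+1))) absolutely_integrable_on {1..}"
      by (intro nonnegative_absolutely_integrable_1) auto
    then show "set_integrable lborel {1..} (\<lambda>t::real. t powr (-(p+1)))"
      unfolding set_integrable_def by (subst (asm) integrable_completion) auto
    show "set_borel_measurable lborel {1..} ?f" by (rule meas) simp
    show "AE t in lborel. t \<in> {1..} \<longrightarrow> norm (?f t) \<le> norm (t powr (-(p+1)))"
    proof (intro AE_I2 impI)
      fix t :: real assume t: "t \<in> {1..}"
      have "0 \<le> (exp (- (t^2) / 2)) powr s" "(exp (- (t^2) / 2)) powr s \<le> 1"
        using s by (auto intro!: powr_le1)
      moreover have "0 \<le> \<bar>cos t\<bar> powr s" "\<bar>cos t\<bar> powr s \<le> 1"
        using s by (auto intro!: powr_le1)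
      ultimately have "\<bar>(exp (- (t^2) / 2)) powr s - \<bar>cos t\<bar> powr s\<bar> \<le> 1" by linarith
      then have "\<bar>?f t\<bar> \<le> 1 / t powr (p + 1)"
        unfolding abs_divide by (simp add: divide_right_mono)
      then show "norm (?f t) \<le> norm (t powr (-(p+1)))"
        unfolding powr_minus_divide real_norm_def by simp
    qed
  qed
  ultimately have "set_integrable lborel ({0<..1} \<union> {1..}) ?f"
    by (rule set_integrable_Un) auto
  moreover have "{0<..1} \<union> {1..} = {0::real<..}" by auto
  ultimately show ?thesis by simp
qed

end

theory Submission
  imports Defs
begin

text \<open>
  Write \<open>g(t) = exp (- t^2/2)\<close> and \<open>D = g^s - |cos|^s\<close>. On \<open>(0, pi]\<close> the curves \<open>g\<close> and \<open>|cos|\<close>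
  cross once, at a point \<open>c > pi/2\<close>, with \<open>g\<close> above \<open>|cos|\<close> before it; beyond \<open>pi\<close> the Gaussian is so
  small that it may be dropped. What remains is nonnegative before \<open>c\<close> and nonpositive after it, and
  \<open>t^(-p-1) = t^(2-p) t^(-3)\<close> with \<open>t^(2-p)\<close> decreasing. Replacing \<open>t^(2-p)\<close> by \<open>c^(2-p)\<close>
  therefore only lowers the integral, which reduces every exponent \<open>p \<ge> 2\<close> to the single kernel
  \<open>t^(-3)\<close> (\<open>gauss_cos_single_crossing\<close>, \<open>scaled_cubic_le_powr_weight\<close>).

  For that kernel the integral over the first arch of the cosine is compared with the Gaussian by a change
  of variables. Since \<open>-2 ln (cos t) = \<tau>^2\<close> with \<open>1/t^2 - 1/\<tau>^2 = 1/6 + t^2/60 + \<dots>\<close>, the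
  substitution \<open>\<tau> = (1/t^2 - 1/6 - t^2/60)^(-1/2)\<close> almost carries \<open>cos\<close> to the Gaussian, and
  \<open>\<tau>^(-3) d\<tau> = (t^(-3) + t/60) dt\<close>. The result, \<open>gauss_minus_cos_integral_ge\<close>, is a
  surplus of the Gaussian of at least \<open>1/12 + \<integral> |cos t|^s t/60 dt\<close> over \<open>(0, pi/2)\<close>. The
  \<open>1/12\<close> comes from the piece between \<open>t\<close> and \<open>\<tau>(t)\<close> as \<open>t\<close> tends to 0.

  The other arches are folded onto \<open>(0, pi/2)\<close>, where they contribute \<open>\<integral> |cos u|^s W(u) du\<close> with
  \<open>W(u) = \<Sum>\<^sub>k (k pi + u)^(-3) + (k pi - u)^(-3)\<close> (\<open>cos_powr_over_cube_integral_fold\<close>). So it remains to see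
  that \<open>\<integral> |cos u|^s (W(u) - u/60) du < 1/12\<close>. The factor \<open>W(u) - u/60\<close> is positive, hence the left-hand side
  decreases in \<open>s\<close> and the case \<open>s = 7/5 < sqrt 2\<close> is enough; there the value is about \<open>0.080\<close>, which
  leaves room for an explicit polynomial bound of \<open>W\<close> and a quadratic bound of \<open>y^(7/5)\<close>
  (\<open>sum_pairs_le_weight_bound\<close>, \<open>powr_le_quadratic\<close>, \<open>weighted_cos_integral\<close>).
\<close>

section \<open>A Gaussian majorant of the cosine\<close>

lemma sin_ge_Taylor:
  fixes t :: real
  assumes "0 \<le> t"
  shows "t - t^3/6 + t^5/120 - t^7/5040 \<le> sin t"
proof -
  have "(\<Sum>m<7. sin_coeff m * t ^ m) = t - t^3/6 + t^5/120"
  proof -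
    have "{..<7::nat} = {0,1,2,3,4,5,6}" by auto
    then show ?thesis by (simp add: sin_coeff_def fact_numeral)
  qed
  with Maclaurin_sin_bound[of t 7] assms
  have "\<bar>sin t - (t - t^3/6 + t^5/120)\<bar> \<le> t^7/5040"
    by (simp add: fact_numeral)
  then show ?thesis by linarith
qed

lemma cos_le_Taylor:
  fixes t :: real
  shows "cos t \<le> 1 - t^2/2 + t^4/24 - t^6/720 + t^8/40320"
proof -
  obtain u where u: "cos t = (\<Sum>m<8. cos_coeff m * t ^ m) + cos (u + 1/2 * real 8 * pi) / fact 8 * t ^ 8"
    using Maclaurin_cos_expansion[of t 8] by blast
  have "(\<Sum>m<8. cos_coeff m * t ^ m) = 1 - t^2/2 + t^4/24 - t^6/720"
  proof -
    have "{..<8::nat} = {0,1,2,3,4,5,6,7}" by auto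
    then show ?thesis by (simp add: cos_coeff_def fact_numeral)
  qed
  moreover have "cos (u + 1/2 * real 8 * pi) * t^8 \<le> 1 * t^8"
    by (intro mult_right_mono) auto
  ultimately show ?thesis using u by (simp add: fact_numeral)
qed

lemma pi_half_bounds: "1570796/1000000 \<le> pi/2" "pi/2 \<le> 1570797/1000000"
  using pi_approx by simp_all

text \<open>
  \<open>den t = t^2 (1/t^2 - 1/6 - t^2/60)\<close>, where \<open>1/6 + t^2/60\<close> is the beginning of the power series of
  \<open>1/t^2 + 1/(2 ln (cos t))\<close>. Thus \<open>t^2 / (2 den t)\<close> is an approximation of \<open>- ln (cos t)\<close>.
\<close>

definition den :: "real \<Rightarrow> real" where "den t = 1 - t^2/6 - t^4/60"

lemma sq_le_of_le_pi_half: 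
  assumes "0 \<le> t" "t \<le> pi/2" shows "t^2 \<le> (5/2::real)"
proof -
  have "t \<le> 1.58" using pi_half_bounds assms by simp
  then have "t^2 \<le> 1.58^2" using assms by (intro power_mono) auto
  then show ?thesis by (simp add: power2_eq_square)
qed

lemma den_bounds: 
  assumes "0 \<le> t" "t \<le> pi/2" shows "1/4 < den t" "den t \<le> 1"
proof -
  have "t^4 = t^2 * t^2" by (simp flip: power_add)
  also have "\<dots> \<le> 5/2 * (5/2)" using sq_le_of_le_pi_half[OF assms] by (intro mult_mono) auto
  finally show "1/4 < den t" using sq_le_of_le_pi_half[OF assms] by (simp add: den_def)
  show "den t \<le> 1" unfolding den_def using zero_le_power2[of t] zero_le_power[OF assms(1), of 4] by linarith
qed

text \<open>
  The derivative form of the majorant: \<open>t (1 + t^4/60) / (den t)^2\<close> is the derivative of \<open>t^2 / (2 den t)\<close>,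
  to be compared with \<open>tan t\<close>. In terms of \<open>x = t^2\<close> the Taylor polynomials leave a difference with a factor
  \<open>x^3\<close>, because \<open>den\<close> was chosen to match the first orders.
\<close>

lemma sin_den_ge:
  assumes "0 \<le> t" "t \<le> pi/2"
  shows "cos t * (t * (1 + t^4/60)) \<le> sin t * (den t)^2"
proof -
  define x where "x = t^2"
  have x: "0 \<le> x" "x \<le> 5/2" using sq_le_of_le_pi_half[OF assms] by (auto simp: x_def)
  have pows: "t^3 = t*x" "t^5 = t*x^2" "t^7 = t*x^3" "t^4 = x^2" "t^6 = x^3" "t^8 = x^4"
    by (simp_all add: x_def flip: power_mult power_Suc)
  let ?S = "1 - x/6 + x^2/120 - x^3/5040"
  let ?C = "1 - x/2 + x^2/24 - x^3/720 + x^4/40320"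
  let ?m = "1 - x/6 - x^2/60"
  have "?S * ?m^2 - ?C * (1 + x^2/60)
      = x^3 * (5/378 - 163/120960*x + 11/453600*x^2 + x^3 * (29/36288000 - x/18144000))"
    by (simp add: field_simps eval_nat_numeral)
  also have "\<dots> \<ge> 0"
    using x by (intro mult_nonneg_nonneg add_nonneg_nonneg) auto
  finally have "?C * (1 + x^2/60) \<le> ?S * ?m^2" by simp
  then have "t * (?C * (1 + x^2/60)) \<le> t * (?S * ?m^2)"
    using assms by (intro mult_left_mono)
  moreover have "cos t * (t * (1 + x^2/60)) \<le> ?C * (t * (1 + x^2/60))"
    using cos_le_Taylor[of t] assms by (intro mult_right_mono) (auto simp: pows x_def[symmetric])
  moreover have "(t * ?S) * ?m^2 \<le> sin t * ?m^2"
    using sin_ge_Taylor[of t] assms by (intro mult_right_mono) (auto simp: pows algebra_simps)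
  ultimately have "cos t * (t * (1 + x^2/60)) \<le> sin t * ?m^2" by (simp only: ac_simps)
  then show ?thesis by (simp add: den_def pows flip: x_def)
qed

lemma has_derivative_den: "(den has_real_derivative (- t/3 - t^3/15)) (at t within A)"
  unfolding den_def[abs_def] by (auto intro!: derivative_eq_intros)

lemma has_derivative_half_sq_div_den:
  assumes "den t \<noteq> 0"
  shows "((\<lambda>t. t^2 / (2 * den t)) has_real_derivative t * (1 + t^4/60) / (den t)^2) (at t)"
proof (rule DERIV_cong)
  show "((\<lambda>t. t^2 / (2 * den t)) has_real_derivative
      (2 * t * (2 * den t) - t^2 * (2 * (- t/3 - t^3/15))) / (2 * den t * (2 * den t))) (at t)"
    using assms by (auto intro!: derivative_eq_intros has_derivative_den)
  have "2 * t * (2 * den t) - t^2 * (2 * (- t/3 - t^3/15)) = 4 * (t * (1 + t^4/60))"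
    by (simp add: den_def field_simps eval_nat_numeral)
  then show "(2 * t * (2 * den t) - t^2 * (2 * (- t/3 - t^3/15))) / (2 * den t * (2 * den t))
      = t * (1 + t^4/60) / (den t)^2"
    using assms by (simp add: power2_eq_square)
qed

lemma cos_le_exp_den:
  assumes "0 \<le> t" "t < pi/2"
  shows "cos t \<le> exp (- (t^2 / (2 * den t)))"
proof -
  let ?f = "\<lambda>u. ln (cos u) + u^2 / (2 * den u)"
  have "?f t \<le> ?f 0"
  proof (rule DERIV_nonpos_imp_nonincreasing[OF assms(1)])
    fix u assume u: "0 \<le> u" "u \<le> t"
    then have c: "cos u > 0" using assms by (intro cos_gt_zero_pi) auto
    have m: "den u > 0" using den_bounds[of u] u assms by simp
    have "(?f has_real_derivative - sin u / cos u + u * (1 + u^4/60) / (den u)^2) (at u)"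
    proof (rule DERIV_add)
      show "((\<lambda>u. ln (cos u)) has_real_derivative - sin u / cos u) (at u)"
        using c by (auto intro!: derivative_eq_intros simp: field_simps)
      show "((\<lambda>u. u^2 / (2 * den u)) has_real_derivative u * (1 + u^4/60) / (den u)^2) (at u)"
        using m by (intro has_derivative_half_sq_div_den) simp
    qed
    moreover have "- sin u / cos u + u * (1 + u^4/60) / (den u)^2 \<le> 0"
      using sin_den_ge[of u] u assms c m by (simp add: field_simps)
    ultimately show "\<exists>y. (?f has_real_derivative y) (at u) \<and> y \<le> 0" by blast
  qed
  then have "ln (cos t) \<le> - (t^2 / (2 * den t))" by simp
  moreover have "cos t > 0" using assms by (intro cos_gt_zero_pi) auto
  ultimately show ?thesis by (metis exp_ln exp_le_cancel_iff)
qed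

section \<open>The weight of the folded arches\<close>

text \<open>
  Convexity of \<open>x^(-3)\<close>: the right-hand side is the mean of \<open>x^(-3)\<close> over the unit interval centred at \<open>x\<close>.
\<close>

lemma recip_cube_le_telescope:
  fixes x :: real
  assumes "1/2 < x"
  shows "1 / x^3 \<le> (1 / (x - 1/2)^2 - 1 / (x + 1/2)^2) / 2"
proof -
  have pos: "0 < x" "0 < x - 1/2" "0 < x + 1/2" "0 < x^2 - 1/4"
    using assms mult_strict_mono[OF assms assms] by (auto simp: power2_eq_square)
  have "(1 / (x - 1/2)^2 - 1 / (x + 1/2)^2) / 2 = x / (x^2 - 1/4)^2"
  proof -
    have "x^2 - 1/4 = (x - 1/2) * (x + 1/2)" by (simp add: power2_eq_square algebra_simps)
    moreover have "(x + 1/2)^2 - (x - 1/2)^2 = 2 * x" by (simp add: power2_eq_square algebra_simps)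
    ultimately show ?thesis
      using pos by (simp add: diff_frac_eq power_mult_distrib)
  qed
  moreover have "1 / x^3 \<le> x / (x^2 - 1/4)^2"
  proof -
    have "(x^2 - 1/4)^2 \<le> (x^2)^2" using pos by (intro power_mono) auto
    then have "(x^2 - 1/4)^2 \<le> x * x^3" by (simp add: eval_nat_numeral mult.assoc)
    then show ?thesis using pos by (simp add: divide_simps)
  qed
  ultimately show ?thesis by simp
qed

lemma pair_sum_cubes:
  fixes a v :: real
  assumes "\<bar>v\<bar> < a"
  shows "1/(a+v)^3 + 1/(a-v)^3 = 2 * a * (a^2 + 3 * v^2) / (a^2 - v^2)^3"
proof -
  have "a^2 - v^2 = (a+v)*(a-v)" by (simp add: power2_eq_square algebra_simps)
  moreover have "a + v \<noteq> 0" "a - v \<noteq> 0" using assms by auto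
  moreover have "(a-v)^3 + (a+v)^3 = 2 * a * (a^2 + 3 * v^2)"
    by (simp add: eval_nat_numeral algebra_simps)
  ultimately show ?thesis by (simp add: add_frac_eq power_mult_distrib)
qed

lemma pair_sum_squares:
  fixes a v :: real
  assumes "\<bar>v\<bar> < a"
  shows "1/(a+v)^2 + 1/(a-v)^2 = 2 * ((a^2 + v^2) / (a^2 - v^2)^2)"
proof -
  have "a^2 - v^2 = (a+v)*(a-v)" by (simp add: power2_eq_square algebra_simps)
  moreover have "a + v \<noteq> 0" "a - v \<noteq> 0" using assms by auto
  moreover have "(a-v)^2 + (a+v)^2 = 2 * (a^2 + v^2)"
    by (simp add: eval_nat_numeral algebra_simps)
  ultimately show ?thesis by (simp add: add_frac_eq power_mult_distrib)
qed

definition lattice_weight :: "nat \<Rightarrow> real \<Rightarrow> real" where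
  "lattice_weight n v = (\<Sum>k=1..n. 1/(real k + v)^3 + 1/(real k - v)^3)"

text \<open>
  Only the terms with \<open>k \<ge> 3\<close> are replaced by their telescoping majorant; for \<open>k = 1\<close> and \<open>k = 2\<close> it is too
  lossy for the final numerical estimate.
\<close>

lemma lattice_weight_le_telescoped:
  assumes "0 \<le> v" "v \<le> 1/2"
  shows "lattice_weight (n+2) v \<le> (1/(1+v)^3 + 1/(1-v)^3) + (1/(2+v)^3 + 1/(2-v)^3)
    + (1/(5/2+v)^2 + 1/(5/2-v)^2) / 2"
proof -
  let ?q = "\<lambda>x::real. (1/(x+v)^2 + 1/(x-v)^2) / 2"
  have "lattice_weight (n+2) v \<le> (1/(1+v)^3 + 1/(1-v)^3) + (1/(2+v)^3 + 1/(2-v)^3)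
    + ?q (5/2) - ?q (real n + 5/2)"
  proof (induction n)
    case 0
    have "{1..2::nat} = {1,2}" by auto
    then show ?case by (simp add: lattice_weight_def)
  next
    case (Suc n)
    have "1/(real n + 3 + v)^3 \<le> (1/(real n + 5/2 + v)^2 - 1/(real n + 7/2 + v)^2) / 2"
      using recip_cube_le_telescope[of "real n + 3 + v"] assms by (simp add: algebra_simps)
    moreover have "1/(real n + 3 - v)^3 \<le> (1/(real n + 5/2 - v)^2 - 1/(real n + 7/2 - v)^2) / 2"
      using recip_cube_le_telescope[of "real n + 3 - v"] assms by (simp add: algebra_simps)
    moreover have "lattice_weight (Suc n + 2) v
        = lattice_weight (n + 2) v + (1/(real n + 3 + v)^3 + 1/(real n + 3 - v)^3)"
      by (simp add: lattice_weight_def algebra_simps)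
    moreover have "real (Suc n) + 5/2 = real n + 7/2" by simp
    ultimately show ?case using Suc.IH by (simp only: add_divide_distrib diff_divide_distrib)
  qed
  moreover have "0 \<le> ?q (real n + 5/2)" by simp
  ultimately show ?thesis by linarith
qed

text \<open>
  Put \<open>y = v^2\<close>. For \<open>k = 1\<close> the first three coefficients \<open>1, 6, 15\<close> are those of the power series of
  \<open>(1 + 3 y) / (1 - y)^3\<close>, and 46 is large enough to cover its remainder up to \<open>y = 1/4\<close>. The other terms
  vary so little that a bound linear in \<open>y\<close> is enough.
\<close>

lemma lattice_weight_le:
  assumes "0 \<le> v" "v \<le> 1/2"
  shows "lattice_weight (n+2) v \<le> 241/100 + 63/5 * v^2 + 30 * v^4 + 92 * v^6"
proof -
  define y where "y = v^2"
  have "v^2 \<le> (1/2)^2" using assms by (intro power_mono) auto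
  then have y: "0 \<le> y" "y \<le> 1/4" by (auto simp: y_def power2_eq_square)
  have vp: "v^2 = y" "v^4 = y^2" "v^6 = y^3" by (simp_all add: y_def flip: power_mult)
  have b1: "1/(1+v)^3 + 1/(1-v)^3 \<le> 2 * (1 + 6*y + 15*y^2 + 46*y^3)"
  proof -
    have "y^3 \<le> y^2 / 4"
      using mult_right_mono[OF y(2), of "y^2"] by (simp add: power2_eq_square power3_eq_cube)
    moreover have "y/2 - 1/16 \<le> y^2"
      using zero_le_power2[of "y - 1/4"] by (simp add: power2_eq_square algebra_simps)
    ultimately have "0 \<le> 18 - 99*y + 123*y^2 - 46*y^3" using y by linarith
    then have "0 \<le> y^3 * (18 - 99*y + 123*y^2 - 46*y^3)" using y by simp
    also have "\<dots> = (1 + 6*y + 15*y^2 + 46*y^3) * (1-y)^3 - (1 + 3*y)"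
      by (simp add: eval_nat_numeral algebra_simps)
    finally have "(1 + 3*y) / (1-y)^3 \<le> 1 + 6*y + 15*y^2 + 46*y^3"
      using y by (simp add: pos_divide_le_eq)
    then have "2 * ((1 + 3*y) / (1-y)^3) \<le> 2 * (1 + 6*y + 15*y^2 + 46*y^3)"
      by (rule mult_left_mono) simp
    moreover have "1/(1+v)^3 + 1/(1-v)^3 = 2 * ((1 + 3*y) / (1-y)^3)"
      using pair_sum_cubes[of v 1] assms by (simp add: vp)
    ultimately show ?thesis by (simp only:)
  qed
  have b2: "1/(2+v)^3 + 1/(2-v)^3 \<le> 1/4 + y/2"
  proof -
    have "y^3 \<le> 1" using y by (simp add: power_le_one)
    then have "0 \<le> 8 - 21*y + 23/4*y^2 - y^3/2" using y zero_le_power2[of y] by linarith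
    then have "0 \<le> y * (8 - 21*y + 23/4*y^2 - y^3/2)" using y by simp
    also have "\<dots> = (1/4 + y/2) * (4-y)^3 - 4 * (4 + 3*y)"
      by (simp add: eval_nat_numeral field_simps)
    finally have "4 * (4 + 3*y) / (4-y)^3 \<le> 1/4 + y/2"
      using y by (simp add: pos_divide_le_eq)
    then show ?thesis using pair_sum_cubes[of v 2] assms by (simp add: vp)
  qed
  have b3: "(1/(5/2+v)^2 + 1/(5/2-v)^2) / 2 \<le> 4/25 + y/10"
  proof -
    have "0 \<le> y * (29/32 - 109/100*y + y^2/10)" 
      using y by (intro mult_nonneg_nonneg add_nonneg_nonneg) auto
    also have "\<dots> = (4/25 + y/10) * (25/4-y)^2 - (25/4 + y)"
      by (simp add: eval_nat_numeral field_simps)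
    finally have "(25/4 + y) / (25/4-y)^2 \<le> 4/25 + y/10"
      using y by (simp add: pos_divide_le_eq)
    moreover have "(5/2)^2 = (25/4::real)" by (simp add: power2_eq_square)
    moreover have "(1/(5/2+v)^2 + 1/(5/2-v)^2) / 2 = ((5/2)^2 + v^2) / ((5/2)^2 - v^2)^2"
      using assms by (subst pair_sum_squares, simp) (rule nonzero_mult_div_cancel_left, simp)
    ultimately show ?thesis by (simp only: vp)
  qed
  have "lattice_weight (n+2) v
      \<le> 2 * (1 + 6*y + 15*y^2 + 46*y^3) + (1/4 + y/2) + (4/25 + y/10)"
    using lattice_weight_le_telescoped[OF assms] add_mono[OF add_mono[OF b1 b2] b3]
    by (rule order_trans)
  then show ?thesis unfolding vp by simp
qed

text \<open>
  The bound of \<open>lattice_weight_le\<close> at \<open>v = t/pi\<close>, divided by \<open>pi^3\<close>, with coefficients rounded up.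
\<close>

definition weight_bound :: "real \<Rightarrow> real" where
  "weight_bound t = 389/5000 + 103/2500 * t^2 + 1/100 * t^4 + 31/10000 * t^6"

lemma continuous_weight_bound: "continuous_on A weight_bound"
  unfolding weight_bound_def by (intro continuous_intros)

lemma sum_pairs_le_weight_bound:
  assumes "0 \<le> u" "u \<le> pi/2"
  shows "(\<Sum>k=1..n+2. 1/(real k * pi + u)^3 + 1/(real k * pi - u)^3) \<le> weight_bound u"
proof -
  define v where "v = u / pi"
  have v: "0 \<le> v" "v \<le> 1/2" using assms by (simp_all add: v_def field_simps)
  have "1/(real k * pi + u)^3 + 1/(real k * pi - u)^3
      = 1/pi^3 * (1/(real k + v)^3 + 1/(real k - v)^3)" for k
  proof -
    have "real k * pi + u = pi * (real k + v)" "real k * pi - u = pi * (real k - v)"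
      by (simp_all add: v_def field_simps)
    then show ?thesis by (simp only: power_mult_distrib) (simp add: distrib_left)
  qed
  then have "(\<Sum>k=1..n+2. 1/(real k * pi + u)^3 + 1/(real k * pi - u)^3)
      = 1/pi^3 * lattice_weight (n+2) v"
    by (simp only: lattice_weight_def sum_distrib_left)
  also have "\<dots> \<le> 1/pi^3 * (241/100 + 63/5 * v^2 + 30 * v^4 + 92 * v^6)"
    using lattice_weight_le[OF v] by (intro mult_left_mono) auto
  also have "\<dots> = 241/100 / pi^3 + 63/5 / pi^5 * u^2 + 30 / pi^7 * u^4 + 92 / pi^9 * u^6"
    by (simp add: v_def field_simps eval_nat_numeral)
  also have "\<dots> \<le> weight_bound u"
  proof -
    have "c / pi^n \<le> d" if "c \<le> d * (31415/10000)^n" "0 \<le> d" for c d n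
    proof -
      have "d * (31415/10000)^n \<le> d * pi^n"
        using pi_approx that by (intro mult_left_mono power_mono) auto
      then show ?thesis using that by (simp add: pos_divide_le_eq)
    qed
    note * = this
    show ?thesis unfolding weight_bound_def
      using *[of "241/100" "389/5000" 3] *[of "63/5" "103/2500" 5] *[of 30 "1/100" 7] *[of 92 "31/10000" 9]
      by (intro add_mono mult_right_mono) (simp_all add: power_divide)
  qed
  finally show ?thesis .
qed

text \<open>Nonnegativity of \<open>weight_bound t - t/60\<close> is what makes the remaining integral decreasing in \<open>s\<close>.\<close>

lemma weight_bound_ge: "t/60 \<le> weight_bound t"
proof -
  \<comment> \<open>The shift makes the linear term of \<open>103/2500 * (t - 125/618)^2\<close> equal to \<open>- t/60\<close>.\<close>
  have "0 \<le> (t - 125/618)^2" by simp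
  then have "t/60 \<le> 389/5000 + 103/2500 * t^2" by (simp add: power2_eq_square algebra_simps)
  moreover have "0 \<le> t^4" "0 \<le> t^6" by simp_all
  ultimately show ?thesis unfolding weight_bound_def by linarith
qed

section \<open>The numerical estimate\<close>

text \<open>
  Concavity of \<open>y^(2/5)\<close>: \<open>y^(7/5)\<close> is at most \<open>y\<close> times the tangent line of \<open>y^(2/5)\<close> near \<open>y = 3/4\<close>, with
  coefficients rounded up. It turns the power of the cosine into a trigonometric polynomial.
\<close>

lemma powr_le_quadratic:
  fixes y s :: real
  assumes "0 \<le> y" "y \<le> 1" "7/5 \<le> s"
  shows "y powr s \<le> 107/200 * y + 951/2000 * y^2"
proof (cases "y = 0")
  case False
  define z where "z = y powr (1/5)"
  have z: "0 \<le> z" and zy: "z^5 = y" and zs: "z^2 = y powr (2/5)"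
    using False assms by (simp_all add: z_def powr_power)
  \<comment> \<open>The point of tangency in \<open>y\<close> is \<open>b^5\<close>, about \<open>3/4\<close>, roughly where the loss in the integral is least.\<close>
  define b :: real where "b = 118/125"
  have "0 \<le> (z - b)^2 * (2*z^3 + 4*b*z^2 + 6*b^2*z + 3*b^3)"
    using z by (simp add: b_def)
  also have "\<dots> = 2*z^5 - 5*b^3*z^2 + 3*b^5"
    by (simp add: eval_nat_numeral algebra_simps)
  finally have "5 * (b^3 * z^2) \<le> 2 * z^5 + 3 * b^5" by simp
  moreover have b: "b^3 = 1643032/1953125" "b^5 = 22877577568/30517578125"
    by (simp_all add: b_def power_divide)
  ultimately have "z^2 \<le> 107/200 + 951/2000 * z^5"
    using zero_le_power[OF z, of 5] unfolding b by linarith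
  then have "y powr (2/5) \<le> 107/200 + 951/2000 * y" by (simp add: zy zs)
  then have "y * y powr (2/5) \<le> y * (107/200 + 951/2000 * y)"
    using assms by (intro mult_left_mono) auto
  moreover have "y powr s \<le> y powr (1 + 2/5)"
    using assms by (intro powr_mono') auto
  moreover have "y powr (1 + 2/5) = y * y powr (2/5)"
    using assms False by (subst powr_add) auto
  ultimately show ?thesis by (simp add: power2_eq_square algebra_simps)
qed auto

text \<open>
  The value of \<open>J\<close> is about \<open>0.08282\<close>; what matters is that \<open>83/1000 < 1/12\<close>.
\<close>

lemma weighted_cos_integral:
  obtains J where "((\<lambda>t. (107/200 * cos t + 951/2000 * (cos t)^2) * (weight_bound t - t/60))
     has_integral J) {0..pi/2}" and "J \<le> 83/1000"
proof -
  let ?f = "\<lambda>t::real. weight_bound t - t/60"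
  \<comment> \<open>Since \<open>2 (cos t)^2 = 1 + cos (2 t)\<close>, the antiderivative consists of an antiderivative \<open>?P\<close> of \<open>?f\<close> and,
    by repeated integration by parts, of the alternating sums \<open>?A1\<close>, \<open>?A2\<close> of the even and the odd derivatives
    of \<open>?f\<close>, with \<open>?B1\<close>, \<open>?B2\<close> their analogues for frequency 2.\<close>
  let ?A1 = "\<lambda>t::real. -9983/5000 - 1/60*t + 2593/2500*t^2 - 83/1000*t^4 + 31/10000*t^6"
  let ?A2 = "\<lambda>t::real. -1/60 + 2593/1250*t - 83/250*t^3 + 93/5000*t^5"
  let ?B1 = "\<lambda>t::real. 1493/80000 - 1/120*t + 1619/40000*t^2 - 53/8000*t^4 + 31/20000*t^6"
  let ?B2 = "\<lambda>t::real. -1/240 + 1619/40000*t - 53/4000*t^3 + 93/20000*t^5"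
  let ?P = "\<lambda>t::real. 389/5000*t - 1/120*t^2 + 103/7500*t^3 + 1/500*t^5 + 31/70000*t^7"
  let ?F = "\<lambda>t::real. 107/200 * (?A1 t * sin t + ?A2 t * cos t)
      + 951/4000 * (?P t + ?B1 t * sin (2*t) + ?B2 t * cos (2*t))"
  have "(?F has_vector_derivative (107/200 * cos t + 951/2000 * (cos t)^2) * ?f t) (at t within {0..pi/2})" for t
  proof -
    have "(?F has_real_derivative (107/200 * cos t + 951/4000 * (1 + cos (2*t))) * ?f t) (at t within {0..pi/2})"
      by (rule derivative_eq_intros refl)+
        (simp add: weight_bound_def field_simps eval_nat_numeral)
    moreover have "107/200 * cos t + 951/4000 * (1 + cos (2*t)) = 107/200 * cos t + 951/2000 * (cos t)^2"
      by (simp add: cos_double_cos)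
    ultimately show ?thesis by (simp only: has_real_derivative_iff_has_vector_derivative)
  qed
  then have "((\<lambda>t. (107/200 * cos t + 951/2000 * (cos t)^2) * ?f t) has_integral (?F (pi/2) - ?F 0)) {0..pi/2}"
    by (intro fundamental_theorem_of_calculus) auto
  moreover have "?F (pi/2) - ?F 0 \<le> 83/1000"
  proof -
    define p where "p = pi/2"
    have p: "1570796/1000000 \<le> p" "p \<le> 1570797/1000000"
      using pi_half_bounds by (simp_all add: p_def)
    have up: "p^n \<le> (1570797/1000000)^n" and lo: "(1570796/1000000)^n \<le> p^n" for n
      using p by (auto intro!: power_mono)
    have pw: "p^2 \<le> 2467404/1000000" "p^3 \<le> 3875790/1000000" "6088062/1000000 \<le> p^4"
        "9563104/1000000 \<le> p^5" "p^6 \<le> 15021745/1000000" "p^7 \<le> 23596112/1000000"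
      using up[of 2] up[of 3] lo[of 4] lo[of 5] up[of 6] up[of 7]
      by (simp_all add: power_divide)
    have "?F p - ?F 0 = (-12687397/12000000) + (-20471/480000000)*p + (2211683/4000000)*p^2 + (513223/80000000)*p^3 + (-8881/200000)*p^4 + (-50403/80000000)*p^5 + (3317/2000000)*p^6 + (29481/280000000)*p^7"
    proof -
      have "sin p = 1" "cos p = 0" "sin (2*p) = 0" "cos (2*p) = -1"
        by (simp_all add: p_def)
      then show ?thesis by (simp add: field_simps)
    qed
    also have "\<dots> \<le> 83/1000"
      using p(1) pw by linarith
    finally show ?thesis by (simp add: p_def)
  qed
  ultimately show ?thesis using that by blast
qed

section \<open>The first arch\<close>

lemma continuous_gauss_over_cube:
  assumes "0 < a"
  shows "continuous_on {a..b} (\<lambda>t. exp (- (s * t^2 / 2)) / t^3 :: real)"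
  using assms by (intro continuous_intros) auto

lemma continuous_cos_powr:
  assumes "0 < (s::real)"
  shows "continuous_on A (\<lambda>t. \<bar>cos t\<bar> powr s)"
  using assms by (intro continuous_on_powr' continuous_intros) auto

lemma cos_powr_le_exp_den:
  assumes "0 \<le> t" "t \<le> pi/2" "0 < s"
  shows "\<bar>cos t\<bar> powr s \<le> exp (- (s * (t^2 / (2 * den t))))"
proof (cases "t = pi/2")
  case False
  then have t: "0 \<le> t" "t < pi/2" using assms by auto
  have "0 \<le> cos t" using t by (intro cos_ge_zero) auto
  then have "\<bar>cos t\<bar> powr s \<le> exp (- (t^2 / (2 * den t))) powr s"
    using cos_le_exp_den[OF t] assms by (intro powr_mono2) auto
  then show ?thesis by (simp add: exp_powr_real mult.commute)
next
  case True
  have "cos t = 0" unfolding True by (rule cos_pi_half)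
  then show ?thesis by simp
qed

lemma has_derivative_div_sqrt_den:
  assumes "0 < den t"
  shows "((\<lambda>t. t / sqrt (den t)) has_real_derivative (1 + t^4/60) / (den t * sqrt (den t))) (at t within A)"
proof -
  have "((\<lambda>t. t / sqrt (den t)) has_real_derivative
      (1 * sqrt (den t) - t * ((- t/3 - t^3/15) * (inverse (sqrt (den t)) / 2))) / (sqrt (den t) * sqrt (den t))) (at t within A)"
    using assms by (auto intro!: derivative_eq_intros has_derivative_den)
  moreover have "(1 * sqrt (den t) - t * ((- t/3 - t^3/15) * (inverse (sqrt (den t)) / 2))) / (sqrt (den t) * sqrt (den t))
     = (1 + t^4/60) / (den t * sqrt (den t))"
  proof -
    have "sqrt (den t) - t * ((- t/3 - t^3/15) * (inverse (sqrt (den t)) / 2))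
        = (den t - t * (- t/3 - t^3/15) / 2) / sqrt (den t)"
      using assms by (simp add: field_simps)
    also have "den t - t * (- t/3 - t^3/15) / 2 = 1 + t^4/60"
      by (simp add: den_def field_simps eval_nat_numeral)
    finally show ?thesis using assms by simp
  qed
  ultimately show ?thesis by simp
qed

text \<open>
  The substitution \<open>\<tau> = g t = t / sqrt (den t)\<close> turns \<open>\<tau>^(-3) d\<tau>\<close> into \<open>(t^(-3) + t/60) dt\<close>
  and the Gaussian at \<open>\<tau>\<close> into \<open>exp (- s t^2 / (2 den t))\<close>, a majorant of \<open>|cos t|^s\<close>. The Gaussian on
  \<open>[e, g e]\<close>, which this does not account for, yields \<open>1/12\<close> in the limit because
  \<open>1/e^2 - 1/(g e)^2 \<ge> 1/6\<close>.
\<close>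

lemma gauss_minus_cos_integral_ge:
  assumes e: "0 < e" "e < pi/2" and s: "0 < s"
  shows "exp (- (s * (e^2 / (2 * den e)))) / 12 + integral {e..pi/2} (\<lambda>t. \<bar>cos t\<bar> powr s * (t/60))
    \<le> integral {e..pi} (\<lambda>t. exp (- (s * t^2 / 2)) / t^3) - integral {e..pi/2} (\<lambda>t. \<bar>cos t\<bar> powr s / t^3)"
proof -
  define f where "f = (\<lambda>t::real. exp (- (s * t^2 / 2)) / t^3)"
  define g where "g = (\<lambda>t. t / sqrt (den t))"
  define E where "E = (\<lambda>t. exp (- (s * (t^2 / (2 * den t)))))"
  have den: "1/4 < den t" "den t \<le> 1" if "e \<le> t" "t \<le> pi/2" for t
    using den_bounds[of t] that e by auto
  have g: "t \<le> g t" "g t \<le> 2 * t" if "e \<le> t" "t \<le> pi/2" for t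
  proof -
    have "sqrt (1/4) \<le> sqrt (den t)" "sqrt (den t) \<le> 1"
      using den[OF that] by (auto intro!: real_sqrt_le_mono)
    then have "1/2 \<le> sqrt (den t)" "sqrt (den t) \<le> 1" by (simp_all add: real_sqrt_divide)
    moreover have "t * sqrt (den t) \<le> t * 1" "t * 1 \<le> t * (2 * sqrt (den t))"
      using calculation that e by (intro mult_left_mono; simp)+
    moreover have "0 < sqrt (den t)" using den[OF that] by simp
    ultimately show "t \<le> g t" "g t \<le> 2 * t"
      by (simp_all add: g_def pos_le_divide_eq pos_divide_le_eq mult.assoc)
  qed
  have "den (pi/2) \<le> den e"
  proof -
    have "e^2 \<le> (pi/2)^2" "e^4 \<le> (pi/2)^4" using e by (intro power_mono; simp)+
    then show ?thesis unfolding den_def by linarith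
  qed
  then have g_mono: "g e \<le> g (pi/2)"
    unfolding g_def using e den[of "pi/2"] by (intro frac_le) auto
  have f_cont: "continuous_on {a..b} f" if "0 < a" for a b
    unfolding f_def using that by (rule continuous_gauss_over_cube)
  have f_int: "f integrable_on {a..b}" if "0 < a" for a b
    using f_cont[OF that] by (rule integrable_continuous_interval)
  have fpos: "0 \<le> f t" if "0 < t" for t using that by (simp add: f_def)

  have fg: "(1 + t^4/60) / (den t * sqrt (den t)) * f (g t) = E t * (1/t^3 + t/60)"
    if "e \<le> t" "t \<le> pi/2" for t
  proof -
    have pos: "0 < den t" "0 < t" using den[OF that] that e by auto
    define r where "r = sqrt (den t)"
    have r: "0 < r" "den t = r^2" using pos by (auto simp: r_def)
    have "s * (g t)^2 / 2 = s * (t^2 / (2 * den t))"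
      using r by (simp add: g_def power_divide flip: r_def)
    then have "f (g t) = E t / (t / r)^3" by (simp add: f_def E_def g_def r_def)
    then show ?thesis using pos r
      by (simp add: r_def[symmetric] field_simps eval_nat_numeral)
  qed
  have "((\<lambda>t. ((1 + t^4/60) / (den t * sqrt (den t))) *\<^sub>R f (g t)) has_integral (integral {g e..g (pi/2)} f)) {e..pi/2}"
  proof (rule has_integral_substitution)
    show "g ` {e..pi/2} \<subseteq> {e..pi}"
      using g by force
    show "(g has_real_derivative (1 + t^4/60) / (den t * sqrt (den t))) (at t within {e..pi/2})"
      if "t \<in> {e..pi/2}" for t
      unfolding g_def using den[of t] that by (intro has_derivative_div_sqrt_den) auto
  qed (use e g_mono f_cont in auto)
  then have sub: "((\<lambda>t. E t * (1/t^3 + t/60)) has_integral (integral {g e..g (pi/2)} f)) {e..pi/2}"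
    by (rule has_integral_eq[rotated]) (use fg in auto)

  have int1: "(\<lambda>t. \<bar>cos t\<bar> powr s * (t/60)) integrable_on {e..pi/2}"
    by (intro integrable_continuous_interval continuous_on_mult continuous_cos_powr s)
      (auto intro!: continuous_intros)
  have int2: "(\<lambda>t. \<bar>cos t\<bar> powr s / t^3) integrable_on {e..pi/2}"
    using e by (intro integrable_continuous_interval continuous_intros continuous_cos_powr s) auto
  have main: "integral {e..pi/2} (\<lambda>t. \<bar>cos t\<bar> powr s * (t/60)) + integral {e..pi/2} (\<lambda>t. \<bar>cos t\<bar> powr s / t^3)
      \<le> integral {g e..g (pi/2)} f"
  proof -
    have "((\<lambda>t. \<bar>cos t\<bar> powr s * (t/60) + \<bar>cos t\<bar> powr s / t^3) has_integral
      (integral {e..pi/2} (\<lambda>t. \<bar>cos t\<bar> powr s * (t/60)) + integral {e..pi/2} (\<lambda>t. \<bar>cos t\<bar> powr s / t^3))) {e..pi/2}"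
      using int1 int2 by (intro has_integral_add integrable_integral)
    then show ?thesis
    proof (rule has_integral_le[OF _ sub])
      fix t assume t: "t \<in> {e..pi/2}"
      have "\<bar>cos t\<bar> powr s * (1/t^3 + t/60) \<le> E t * (1/t^3 + t/60)"
        unfolding E_def using t e s by (intro mult_right_mono cos_powr_le_exp_den) auto
      then show "\<bar>cos t\<bar> powr s * (t/60) + \<bar>cos t\<bar> powr s / t^3 \<le> E t * (1/t^3 + t/60)"
        by (simp add: algebra_simps)
    qed
  qed

  have first: "E e / 12 \<le> integral {e..g e} f"
  proof -
    have "e \<le> g e" using g[of e] e by simp
    have "((\<lambda>t. E e * (1/t^3)) has_integral (E e * (-1/(2 * (g e)^2) - (-1/(2 * e^2))))) {e..g e}"
    proof (intro has_integral_mult_right fundamental_theorem_of_calculus \<open>e \<le> g e\<close>)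
      fix t assume "t \<in> {e..g e}"
      then have "t \<noteq> 0" using e by auto
      then show "((\<lambda>t. -1/(2 * t^2)) has_vector_derivative 1/t^3) (at t within {e..g e})"
        unfolding has_real_derivative_iff_has_vector_derivative[symmetric]
        by (auto intro!: derivative_eq_intros simp: field_simps eval_nat_numeral)
    qed
    then have "E e * (-1/(2 * (g e)^2) - (-1/(2 * e^2))) \<le> integral {e..g e} f"
    proof (rule has_integral_le[OF _ integrable_integral[OF f_int]])
      fix t assume t: "t \<in> {e..g e}"
      then have "0 < t" using e by auto
      have "t^2 \<le> (g e)^2" using t e by (intro power_mono) auto
      then have "s * t^2 / 2 \<le> s * (g e)^2 / 2" using s by simp
      also have "\<dots> = s * (e^2 / (2 * den e))"
        using den[of e] e by (simp add: g_def power_divide)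
      finally have "E e \<le> exp (- (s * t^2 / 2))" by (simp add: E_def)
      then show "E e * (1/t^3) \<le> f t" using \<open>0 < t\<close> by (simp add: f_def divide_right_mono)
    qed (use e in auto)
    moreover have "-1/(2 * (g e)^2) - (-1/(2 * e^2)) = 1/12 + e^2/120"
      using den[of e] e by (simp add: g_def power_divide den_def field_simps eval_nat_numeral)
    moreover have "E e * (1/12) \<le> E e * (1/12 + e^2/120)"
      by (intro mult_left_mono) (auto simp: E_def)
    ultimately show ?thesis by simp
  qed

  have "integral {e..g e} f + integral {g e..g (pi/2)} f + integral {g (pi/2)..pi} f = integral {e..pi} f"
  proof -
    have "e \<le> g e" "g (pi/2) \<le> pi" using g[of e] g[of "pi/2"] e by auto
    then show ?thesis
      using g_mono e f_int[of e pi] f_int[of e "g (pi/2)"]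
      by (simp add: Henstock_Kurzweil_Integration.integral_combine)
  qed
  moreover have "0 \<le> integral {g (pi/2)..pi} f"
    using g[of "pi/2"] e fpos by (intro integral_nonneg f_int) auto
  ultimately show ?thesis using main first unfolding f_def E_def by linarith
qed

section \<open>Folding the other arches\<close>

lemma integral_reflect_shift:
  fixes h :: "real \<Rightarrow> real"
  assumes "continuous_on {c-b..c} h" "0 \<le> b"
  shows "integral {c-b..c} h = integral {0..b} (\<lambda>u. h (c - u))"
proof -
  have "integral {c-b..c} h = integral {-c..b-c} (\<lambda>x. h (-x))"
    using Henstock_Kurzweil_Integration.integral_reflect_real[of "c" "c-b" h] by simp
  also have "\<dots> = integral {0..b} ((\<lambda>x. h (-x)) \<circ> (\<lambda>x. x + -c))"
  proof -
    have "continuous_on {0 + -c..b + -c} (\<lambda>x. h (-x))"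
      by (rule continuous_on_compose2[OF assms(1)]) (auto intro!: continuous_intros)
    from integral_shift[OF this] show ?thesis by simp
  qed
  finally show ?thesis by (simp add: o_def)
qed

lemma abs_cos_shift_multiple_pi:
  "\<bar>cos (real k * pi + u)\<bar> = \<bar>cos u\<bar>" "\<bar>cos (real k * pi - u)\<bar> = \<bar>cos u\<bar>"
  by (simp_all add: cos_add cos_diff abs_mult)

lemma multiple_pi_plus_minus_nonzero:
  assumes "1 \<le> k" "u \<in> {0..pi/2}"
  shows "real k * pi + u \<noteq> 0" "real k * pi - u \<noteq> 0"
proof -
  have "1 * pi \<le> real k * pi" using assms by (intro mult_right_mono) auto
  moreover have "0 \<le> u" "u \<le> pi/2" using assms by simp_all
  ultimately show "real k * pi + u \<noteq> 0" "real k * pi - u \<noteq> 0" using pi_gt_zero by linarith+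
qed

lemma cos_powr_over_cube_integral_fold:
  assumes s: "0 < s"
  shows "integral {pi/2..pi/2 + real n * pi} (\<lambda>t. \<bar>cos t\<bar> powr s / t^3)
    = integral {0..pi/2} (\<lambda>u. \<bar>cos u\<bar> powr s * (\<Sum>k=1..n. 1/(real k * pi + u)^3 + 1/(real k * pi - u)^3))"
proof (induction n)
  case 0
  then show ?case by simp
next
  case (Suc n)
  define h where "h = (\<lambda>t. \<bar>cos t\<bar> powr s / t^3)"
  have h_cont: "continuous_on {a..b} h" if "0 < a" for a b
    unfolding h_def using that s by (intro continuous_intros continuous_cos_powr) auto
  let ?c = "real (Suc n) * pi"
  let ?w = "\<lambda>k u. 1/(real k * pi + u)^3 + 1/(real k * pi - u)^3"
  have cont: "continuous_on {0..pi/2} (\<lambda>u. \<bar>cos u\<bar> powr s * (1/(real k * pi + u)^3))"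
    "continuous_on {0..pi/2} (\<lambda>u. \<bar>cos u\<bar> powr s * (1/(real k * pi - u)^3))" if "k \<in> {1..Suc n}" for k
    using multiple_pi_plus_minus_nonzero[of k] that s
    by (intro continuous_intros continuous_cos_powr; simp)+
  note int = cont[THEN integrable_continuous_interval]
  have i: "(\<lambda>u. \<bar>cos u\<bar> powr s * ?w k u) integrable_on {0..pi/2}" if "k \<in> {1..Suc n}" for k
    using integrable_add[OF int[OF that]] by (simp only: distrib_left)
  have c: "0 < ?c - pi/2" "?c - pi/2 = pi/2 + real n * pi" "?c + pi/2 = pi/2 + real (Suc n) * pi"
    by (simp_all add: field_simps add_pos_nonneg)
  have "integral {?c - pi/2..?c} h = integral {0..pi/2} (\<lambda>u. \<bar>cos u\<bar> powr s * (1/(?c - u)^3))"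
    by (subst integral_reflect_shift[OF h_cont[OF c(1)]]) (simp_all only: h_def abs_cos_shift_multiple_pi, simp_all)
  moreover have "integral {?c..?c + pi/2} h = integral {0..pi/2} (\<lambda>u. \<bar>cos u\<bar> powr s * (1/(?c + u)^3))"
  proof -
    have "integral {0 + ?c..pi/2 + ?c} h = integral {0..pi/2} (h \<circ> (\<lambda>x. x + ?c))"
      by (rule integral_shift[symmetric]) (rule h_cont, simp)
    then show ?thesis
      by (simp only: o_def add.commute[of _ ?c] h_def abs_cos_shift_multiple_pi) simp
  qed
  moreover have "integral {?c - pi/2..?c} h + integral {?c..?c + pi/2} h = integral {?c - pi/2..?c + pi/2} h"
    by (intro Henstock_Kurzweil_Integration.integral_combine integrable_continuous_interval h_cont c) auto
  moreover have "integral {0..pi/2} (\<lambda>u. \<bar>cos u\<bar> powr s * (1/(?c + u)^3)) + integral {0..pi/2} (\<lambda>u. \<bar>cos u\<bar> powr s * (1/(?c - u)^3))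
      = integral {0..pi/2} (\<lambda>u. \<bar>cos u\<bar> powr s * ?w (Suc n) u)"
    using integral_add[OF int[of "Suc n"]] by (simp only: distrib_left) simp
  moreover have "integral {pi/2..pi/2 + real n * pi} h + integral {pi/2 + real n * pi..pi/2 + real (Suc n) * pi} h
      = integral {pi/2..pi/2 + real (Suc n) * pi} h"
    by (intro Henstock_Kurzweil_Integration.integral_combine integrable_continuous_interval h_cont) (auto simp: field_simps)
  ultimately have "integral {pi/2..pi/2 + real (Suc n) * pi} h = integral {pi/2..pi/2 + real n * pi} h
      + integral {0..pi/2} (\<lambda>u. \<bar>cos u\<bar> powr s * ?w (Suc n) u)"
    unfolding c(2,3) by linarith
  also have "\<dots> = integral {0..pi/2} (\<lambda>u. \<bar>cos u\<bar> powr s * (\<Sum>k=1..n. ?w k u) + \<bar>cos u\<bar> powr s * ?w (Suc n) u)"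
    unfolding h_def Suc.IH
    by (intro Henstock_Kurzweil_Integration.integral_add[symmetric] i)
      (auto simp: sum_distrib_left intro!: integrable_sum i)
  finally show ?case by (simp add: h_def distrib_left)
qed

section \<open>The kernel of exponent three\<close>

lemma truncation_point_le_one:
  fixes e s :: real
  assumes "7/5 \<le> s" "e^2 * (10 * s + 1) \<le> 1/50"
  shows "e \<le> 1"
proof -
  have "e^2 * 1 \<le> e^2 * (10 * s + 1)" using assms by (intro mult_left_mono) auto
  then have "e^2 \<le> 1" using assms(2) by linarith
  then have "e^2 \<le> 1^2" by simp
  then show ?thesis by (rule power2_le_imp_le) simp
qed

text \<open>
  The case \<open>p = 2\<close> on \<open>[e, pi/2 + (n+2) pi]\<close>, with the Gaussian dropped beyond \<open>pi\<close>. The margin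
  \<open>1/12 - 83/1000 = 1/3000\<close> absorbs the errors of order \<open>s e^2\<close> that come from stopping at \<open>e\<close>; the
  condition on \<open>e\<close> says precisely that it does.
\<close>

lemma truncated_cubic_integral_nonneg:
  assumes s: "7/5 \<le> s" and e: "0 < e" "e^2 * (10 * s + 1) \<le> 1/50"
  shows "integral {e..pi/2 + real (n+2) * pi} (\<lambda>t. \<bar>cos t\<bar> powr s / t^3)
    \<le> integral {e..pi} (\<lambda>t. exp (- (s * t^2 / 2)) / t^3)"
proof -
  let ?c = "\<lambda>t. \<bar>cos t\<bar> powr s"
  let ?W = "\<lambda>u. \<Sum>k=1..n+2. 1/(real k * pi + u)^3 + 1/(real k * pi - u)^3"
  have s0: "0 < s" using s by simp
  have e': "e < pi/2" using truncation_point_le_one[OF s e(2)] pi_gt3 by simp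
  have c_int: "(\<lambda>t. ?c t * q t) integrable_on {a..b}" if "continuous_on {a..b} q" for a b q
    using that by (intro integrable_continuous_interval continuous_on_mult continuous_cos_powr s0)
  have c3_int: "(\<lambda>t. ?c t / t^3) integrable_on {a..b}" if "0 < a" for a b
    using that by (intro integrable_continuous_interval continuous_intros continuous_cos_powr s0) auto

  have split: "integral {e..pi/2} (\<lambda>t. ?c t / t^3) + integral {pi/2..pi/2 + real (n+2) * pi} (\<lambda>t. ?c t / t^3)
      = integral {e..pi/2 + real (n+2) * pi} (\<lambda>t. ?c t / t^3)"
    using e' by (intro Henstock_Kurzweil_Integration.integral_combine c3_int e) auto
  have far: "integral {pi/2..pi/2 + real (n+2) * pi} (\<lambda>t. ?c t / t^3) \<le> integral {0..pi/2} (\<lambda>u. ?c u * weight_bound u)"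
  proof -
    have "integral {0..pi/2} (\<lambda>u. ?c u * ?W u) \<le> integral {0..pi/2} (\<lambda>u. ?c u * weight_bound u)"
    proof (rule integral_le)
      show "(\<lambda>u. ?c u * ?W u) integrable_on {0..pi/2}"
        using multiple_pi_plus_minus_nonzero by (intro c_int continuous_intros) auto
      show "(\<lambda>u. ?c u * weight_bound u) integrable_on {0..pi/2}"
        by (intro c_int continuous_weight_bound)
      show "?c u * ?W u \<le> ?c u * weight_bound u" if "u \<in> {0..pi/2}" for u
        using that by (intro mult_left_mono sum_pairs_le_weight_bound) auto
    qed
    then show ?thesis by (simp only: cos_powr_over_cube_integral_fold[OF s0])
  qed
  have small: "integral {0..e} (\<lambda>t. ?c t * (t/60)) \<le> e^2/60"
  proof -
    have "?c t * (t/60) \<le> e/60" if "t \<in> {0..e}" for t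
    proof -
      have "?c t * (t/60) \<le> 1 * (e/60)"
        using that s0 by (intro mult_mono powr_le1) auto
      then show ?thesis by simp
    qed
    then have "integral {0..e} (\<lambda>t. ?c t * (t/60)) \<le> integral {0..e} (\<lambda>t. e/60)"
      by (intro integral_le c_int) (auto intro!: continuous_intros)
    then show ?thesis using e by (simp add: power2_eq_square)
  qed
  have glue: "integral {0..e} (\<lambda>t. ?c t * (t/60)) + integral {e..pi/2} (\<lambda>t. ?c t * (t/60)) = integral {0..pi/2} (\<lambda>t. ?c t * (t/60))"
    using e e' by (intro Henstock_Kurzweil_Integration.integral_combine c_int continuous_intros) auto
  have bulk: "integral {0..pi/2} (\<lambda>u. ?c u * weight_bound u) - integral {0..pi/2} (\<lambda>t. ?c t * (t/60)) \<le> 83/1000"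
  proof -
    obtain J where J: "((\<lambda>t. (107/200 * cos t + 951/2000 * (cos t)^2) * (weight_bound t - t/60)) has_integral J) {0..pi/2}"
      "J \<le> 83/1000" by (rule weighted_cos_integral)
    have "((\<lambda>t. ?c t * weight_bound t - ?c t * (t/60)) has_integral
        (integral {0..pi/2} (\<lambda>u. ?c u * weight_bound u) - integral {0..pi/2} (\<lambda>t. ?c t * (t/60)))) {0..pi/2}"
      by (intro has_integral_diff integrable_integral c_int continuous_weight_bound)
        (intro continuous_on_divide continuous_on_id continuous_on_const, simp)
    then have "integral {0..pi/2} (\<lambda>u. ?c u * weight_bound u) - integral {0..pi/2} (\<lambda>t. ?c t * (t/60)) \<le> J"
    proof (rule has_integral_le[OF _ J(1)])
      fix t assume t: "t \<in> {0..pi/2}"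
      then have "0 \<le> cos t" by (intro cos_ge_zero) auto
      then have "?c t \<le> 107/200 * cos t + 951/2000 * (cos t)^2"
        using powr_le_quadratic[of "cos t" s] s by simp
      then have "?c t * (weight_bound t - t/60) \<le> (107/200 * cos t + 951/2000 * (cos t)^2) * (weight_bound t - t/60)"
        using weight_bound_ge[of t] by (intro mult_right_mono) auto
      then show "?c t * weight_bound t - ?c t * (t/60)
          \<le> (107/200 * cos t + 951/2000 * (cos t)^2) * (weight_bound t - t/60)"
        by (simp only: right_diff_distrib)
    qed
    with J(2) show ?thesis by linarith
  qed
  have "1 - 2 * s * e^2 \<le> exp (- (s * (e^2 / (2 * den e))))"
  proof -
    have "s * (e^2 / (2 * den e)) \<le> s * (e^2 / (1/2))"
      using den_bounds[of e] e e' s0 by (intro mult_left_mono divide_left_mono) auto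
    then show ?thesis using exp_ge_add_one_self[of "- (s * (e^2 / (2 * den e)))"] by simp
  qed
  moreover have "2 * s * e^2 / 12 + e^2/60 \<le> 1/3000" using e by (simp add: algebra_simps)
  ultimately show ?thesis
    using gauss_minus_cos_integral_ge[OF e(1) e' s0] split far small glue bulk by linarith
qed

section \<open>Reduction to the kernel of exponent three\<close>

text \<open>
  Up to \<open>pi/2\<close> the Gaussian dominates because \<open>den t \<le> 1\<close> in \<open>cos_le_exp_den\<close>; on \<open>[pi/2, pi]\<close> it decreases
  while \<open>|cos|\<close> increases to 1, which gives exactly one crossing there.
\<close>

lemma gauss_cos_single_crossing:
  obtains c where "0 < c" "c \<le> pi"
    "\<And>t. 0 \<le> t \<Longrightarrow> t \<le> c \<Longrightarrow> \<bar>cos t\<bar> \<le> exp (- (t^2) / 2)"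
    "\<And>t. c \<le> t \<Longrightarrow> t \<le> pi \<Longrightarrow> exp (- (t^2) / 2) \<le> \<bar>cos t\<bar>"
proof -
  let ?h = "\<lambda>t. exp (- (t^2) / 2) + cos t"
  have anti: "?h u \<le> ?h t" if "pi/2 \<le> t" "t \<le> u" "u \<le> pi" for t u
  proof -
    have "0 \<le> t" using that pi_gt_zero by linarith
    then have "t^2 \<le> u^2" and cos: "cos u \<le> cos t"
      using that by (auto intro!: power_mono cos_monotone_0_pi_le)
    then have "exp (- (u^2) / 2) \<le> exp (- (t^2) / 2)" by simp
    then show ?thesis using cos by (rule add_mono)
  qed
  have abs_cos: "\<bar>cos t\<bar> = - cos t" if "pi/2 \<le> t" "t \<le> pi" for t
    using cos_monotone_0_pi_le[of "pi/2" t] that by (simp add: cos_pi_half)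
  have "\<exists>c\<ge>pi/2. c \<le> pi \<and> ?h c = 0"
    by (rule IVT2') (auto intro!: continuous_intros)
  then obtain c where c: "pi/2 \<le> c" "c \<le> pi" "?h c = 0" by blast
  show ?thesis
  proof (rule that[of c])
    fix t assume t: "0 \<le> t" "t \<le> c"
    show "\<bar>cos t\<bar> \<le> exp (- (t^2) / 2)"
    proof (cases "t < pi/2")
      case True
      then have "\<bar>cos t\<bar> = cos t" using t by (intro abs_of_nonneg cos_ge_zero) auto
      also have "\<dots> \<le> exp (- (t^2 / (2 * den t)))"
        using t True by (intro cos_le_exp_den)
      also have "\<dots> \<le> exp (- (t^2) / 2)"
      proof -
        have "t^2 / 2 \<le> t^2 / (2 * den t)"
          using den_bounds[of t] t True by (intro divide_left_mono) auto
        then show ?thesis by simp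
      qed
      finally show ?thesis .
    next
      case False
      then show ?thesis using anti[of t c] abs_cos[of t] t c by simp
    qed
  next
    fix t assume t: "c \<le> t" "t \<le> pi"
    then show "exp (- (t^2) / 2) \<le> \<bar>cos t\<bar>"
      using anti[of c t] abs_cos[of t] c by simp
  qed (use c pi_gt_zero in linarith)+
qed

lemma scaled_cubic_le_powr_weight:
  fixes p t c d :: real
  assumes p: "2 \<le> p" and t: "0 < t" and c: "0 < c"
    and sign: "t < c \<Longrightarrow> 0 \<le> d" "c < t \<Longrightarrow> d \<le> 0"
  shows "c powr (2 - p) * (d / t^3) \<le> d / t powr (p + 1)"
proof -
  have "t powr (p + 1) = t powr (p - 2 + 3)" by (simp add: add.commute)
  also have "\<dots> = t powr (p - 2) * t^3" using t by (subst powr_add) simp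
  finally have eq: "d / t powr (p + 1) = t powr (2 - p) * (d / t^3)"
    using t powr_minus_divide[of t "p - 2"] by simp
  consider "t < c" | "t = c" | "c < t" by linarith
  then show ?thesis
  proof cases
    case 1
    then show ?thesis unfolding eq
      using p t sign(1) by (intro mult_right_mono powr_mono2') auto
  next
    case 2
    then show ?thesis unfolding eq by simp
  next
    case 3
    then show ?thesis unfolding eq
      using p t c sign(2) by (intro mult_right_mono_neg powr_mono2' divide_nonpos_pos) auto
  qed
qed

text \<open>
  Beyond \<open>pi\<close>, where \<open>exp (- t^2/2) - |cos t|\<close> changes sign again near every zero of the cosine, the Gaussian is
  bounded below by 0.
\<close>

lemma truncated_integral_nonneg:
  assumes p: "2 \<le> p" and s: "7/5 \<le> s" and e: "0 < e" "e^2 * (10 * s + 1) \<le> 1/50"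
  shows "0 \<le> integral {e..pi/2 + real (n+2) * pi}
    (\<lambda>t. ((exp (- (t^2) / 2)) powr s - \<bar>cos t\<bar> powr s) / t powr (p + 1))"
proof -
  let ?T = "pi/2 + real (n+2) * pi"
  let ?c = "\<lambda>t. \<bar>cos t\<bar> powr s"
  let ?g = "\<lambda>t. (exp (- (t^2) / 2)) powr s"
  let ?f = "\<lambda>t. (?g t - ?c t) / t powr (p + 1)"
  have s0: "0 < s" using s by simp
  have e': "e < pi" using truncation_point_le_one[OF s e(2)] pi_gt3 by simp
  have "1 * pi \<le> real (n+2) * pi" by (intro mult_right_mono) auto
  then have T: "pi \<le> ?T" using pi_gt_zero by linarith
  obtain c where c: "0 < c" "c \<le> pi"
    "\<And>t. 0 \<le> t \<Longrightarrow> t \<le> c \<Longrightarrow> \<bar>cos t\<bar> \<le> exp (- (t^2) / 2)"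
    "\<And>t. c \<le> t \<Longrightarrow> t \<le> pi \<Longrightarrow> exp (- (t^2) / 2) \<le> \<bar>cos t\<bar>"
    by (rule gauss_cos_single_crossing) blast
  let ?K = "c powr (2 - p)"
  have f_int: "?f integrable_on {a..b}" if "0 < a" for a b
    using that s0 by (intro integrable_continuous_interval continuous_intros continuous_cos_powr) auto
  have c3_int: "(\<lambda>t. ?c t / t^3) integrable_on {a..b}" if "0 < a" for a b
    using that by (intro integrable_continuous_interval continuous_intros continuous_cos_powr s0) auto
  have g3_int: "(\<lambda>t. ?g t / t^3) integrable_on {a..b}" if "0 < a" for a b
    using that by (intro integrable_continuous_interval continuous_intros) auto

  have near: "?K * (integral {e..pi} (\<lambda>t. ?g t / t^3) - integral {e..pi} (\<lambda>t. ?c t / t^3)) \<le> integral {e..pi} ?f"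
  proof -
    have "((\<lambda>t. ?K * (?g t / t^3 - ?c t / t^3)) has_integral
        (?K * (integral {e..pi} (\<lambda>t. ?g t / t^3) - integral {e..pi} (\<lambda>t. ?c t / t^3)))) {e..pi}"
      by (intro has_integral_mult_right has_integral_diff integrable_integral c3_int g3_int e)
    then show ?thesis
    proof (rule has_integral_le[OF _ integrable_integral[OF f_int[OF e(1)]]])
      fix t assume t: "t \<in> {e..pi}"
      have "?K * ((?g t - ?c t) / t^3) \<le> ?f t"
        using t e p c s0
        by (intro scaled_cubic_le_powr_weight) (auto intro!: powr_mono2)
      then show "?K * (?g t / t^3 - ?c t / t^3) \<le> ?f t" by (simp only: diff_divide_distrib)
    qed
  qed
  have far: "?K * (- integral {pi..?T} (\<lambda>t. ?c t / t^3)) \<le> integral {pi..?T} ?f"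
  proof -
    have "((\<lambda>t. ?K * (- (?c t / t^3))) has_integral (?K * (- integral {pi..?T} (\<lambda>t. ?c t / t^3)))) {pi..?T}"
      by (intro has_integral_mult_right has_integral_neg integrable_integral c3_int pi_gt_zero)
    then show ?thesis
    proof (rule has_integral_le[OF _ integrable_integral[OF f_int[OF pi_gt_zero]]])
      fix t assume t: "t \<in> {pi..?T}"
      then have "c \<le> t" "0 < t" using c pi_gt_zero by (auto intro: less_le_trans)
      have "?K * (- ?c t / t^3) \<le> - ?c t / t powr (p + 1)"
        using \<open>c \<le> t\<close> \<open>0 < t\<close> p c(1) by (intro scaled_cubic_le_powr_weight) auto
      also have "\<dots> \<le> ?f t" by (intro divide_right_mono) auto
      finally show "?K * (- (?c t / t^3)) \<le> ?f t" by simp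
    qed
  qed
  have "integral {e..?T} (\<lambda>t. ?c t / t^3) \<le> integral {e..pi} (\<lambda>t. ?g t / t^3)"
    using truncated_cubic_integral_nonneg[OF s e, of n]
    by (simp add: exp_powr_real mult.commute)
  moreover have "integral {e..pi} (\<lambda>t. ?c t / t^3) + integral {pi..?T} (\<lambda>t. ?c t / t^3) = integral {e..?T} (\<lambda>t. ?c t / t^3)"
    using e' T by (intro Henstock_Kurzweil_Integration.integral_combine c3_int e) auto
  ultimately have "0 \<le> ?K * (integral {e..pi} (\<lambda>t. ?g t / t^3) - integral {e..pi} (\<lambda>t. ?c t / t^3)
      - integral {pi..?T} (\<lambda>t. ?c t / t^3))"
    by (intro mult_nonneg_nonneg) auto
  also have "\<dots> = ?K * (integral {e..pi} (\<lambda>t. ?g t / t^3) - integral {e..pi} (\<lambda>t. ?c t / t^3))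
      + ?K * (- integral {pi..?T} (\<lambda>t. ?c t / t^3))" by (simp add: algebra_simps)
  also have "\<dots> \<le> integral {e..pi} ?f + integral {pi..?T} ?f"
    using near far by (rule add_mono)
  also have "\<dots> = integral {e..?T} ?f"
    using e' T by (intro Henstock_Kurzweil_Integration.integral_combine f_int e) auto
  finally show ?thesis .
qed

text \<open>
  By integrability, the integral is the limit of those over \<open>[d/(n+1), pi/2 + (n+2) pi]\<close>; the left endpoints
  start small enough for \<open>truncated_integral_nonneg\<close>.
\<close>

theorem mainTheorem1:
  fixes p s :: real
  assumes "2 < p" and "p < 3" and "s \<ge> sqrt 2"
  shows "(LBINT t:{0<..}.
    ((exp (- (t^2) / 2)) powr s - \<bar>cos t\<bar> powr s) / t powr (p + 1)) \<ge> 0"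
proof -
  let ?f = "\<lambda>t. ((exp (- (t^2) / 2)) powr s - \<bar>cos t\<bar> powr s) / t powr (p + 1)"
  have "sqrt ((7/5)^2) \<le> sqrt 2" by (intro real_sqrt_le_mono) (simp add: power2_eq_square)
  then have s: "7/5 \<le> s" using assms(3) by simp
  \<comment> \<open>This choice gives \<open>d^2 * (10 * s + 1) = d / 10\<close>.\<close>
  define d where "d = 1 / (10 * (10 * s + 1))"
  define A where "A n = {d / real (Suc n)..pi/2 + real (n+2) * pi}" for n
  have d: "0 < d" using s by (simp add: d_def)
  have int: "set_integrable lborel {0<..} ?f"
    using assms s by (intro gauss_cos_integrable) auto
  have un: "(\<Union>n. A n) = {0<..}"
  proof
    show "(\<Union>n. A n) \<subseteq> {0<..}"
      using d by (auto simp: A_def intro: less_le_trans[rotated])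
    show "{0<..} \<subseteq> (\<Union>n. A n)"
    proof
      fix t :: real assume "t \<in> {0<..}"
      then have t: "0 < t" by simp
      obtain n where n: "max (d / t) t < real n" using reals_Archimedean2 by blast
      have "d / real (Suc n) \<le> t"
        using n t by (simp add: field_simps)
      moreover have "t \<le> pi/2 + real (n+2) * pi"
      proof -
        have "real n * 1 \<le> real n * pi" using pi_gt3 by (intro mult_left_mono) auto
        then show ?thesis using n pi_gt3 by (simp add: algebra_simps)
      qed
      ultimately show "t \<in> (\<Union>n. A n)" by (auto simp: A_def)
    qed
  qed
  have "(\<lambda>n. LBINT t:A n. ?f t) \<longlonglongrightarrow> (LBINT t:(\<Union>n. A n). ?f t)"
  proof (rule set_integral_cont_up)
    show "incseq A"
      unfolding incseq_Suc_iff A_def using d by (auto simp: field_simps)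
  qed (use int un in \<open>auto simp: A_def\<close>)
  moreover have "0 \<le> (LBINT t:A n. ?f t)" for n
  proof -
    have "set_integrable lborel (A n) ?f"
      using un by (intro set_integrable_subset[OF int]) (auto simp: A_def)
    then have "(LBINT t:A n. ?f t) = integral (A n) ?f"
      by (rule set_borel_integral_eq_integral)
    also have "0 \<le> integral (A n) ?f"
      unfolding A_def
    proof (rule truncated_integral_nonneg)
      have "(d / real (Suc n))^2 \<le> d^2"
        using d by (intro power_mono) (auto simp: field_simps)
      then have "(d / real (Suc n))^2 * (10 * s + 1) \<le> d^2 * (10 * s + 1)"
        using s by (intro mult_right_mono) auto
      also have "\<dots> = d / 10"
      proof -
        have "d * (10 * s + 1) = 1 / 10" using s by (simp add: d_def field_simps)
        then show ?thesis by (simp add: power2_eq_square mult.assoc)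
      qed
      also have "\<dots> \<le> 1/50" using s by (simp add: d_def field_simps)
      finally show "(d / real (Suc n))^2 * (10 * s + 1) \<le> 1/50" .
    qed (use assms s d in auto)
    finally show ?thesis .
  qed
  ultimately show ?thesis
    unfolding un by (intro LIMSEQ_le_const) auto
qed

end
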